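(* Let $F:\mathscr{D}(F)\subseteq U\to H$ and $h$ satisfy (A1)–(A7) of the context, and let $\bar u$, $\xi\in\partial h(\bar u)$, $\rho>0$ and $c>0$ satisfy the nonlinearity assumption (N) of the context. Let $\delta>0$ and let $y^\delta\in H$ satisfy $\|y-y^\delta\|<\delta$. Assume moreover that there exists $\omega\in H^*$ such that $\xi=F'(\bar u)^*\omega\in\partial h(\bar u)$ and $c\,\|\omega\|_{H^*}<1$. Let $\alpha>0$ and let $u_\alpha^\delta$ be a minimizer of $J_\alpha^\delta(u)=\frac12\|F(u)-y^\delta\|^2+\alpha h(u)$. Then $$\|F(u_\alpha^\delta)-F(\bar u)\|\le 2\alpha\|\omega\|_{H^*}+2\left(\alpha^2\|\omega\|_{H^*}^2+\delta^2\right)^{1/2},$$ $$D_h^{F'(\bar u)^*\omega}(u_\alpha^\delta,\bar u)\le\frac{2}{1-c\|\omega\|_{H^*}}\left[\frac{\delta^2}{2\alpha}+\alpha\|\omega\|_{H^*}^2+\|\omega\|_{H^*}\left(\alpha^2\|\omega\|_{H^*}^2+\delta^2\right)^{1/2}\right].$$ In particular, if $\alpha\sim\delta$, then $\|F(u_\alpha^\delta)-F(\bar u)\|=O(\delta)$ and $D_h^{F'(\bar u)^*\omega}(u_\alpha^\delta,\bar u)=O(\delta)$.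
   Context: $U,H$ are (infinite-dimensional) Banach spaces with duals $U^*,H^*$; $\langle\cdot,\cdot\rangle$ is the duality pairing; $y\in H$ is the exact datum of the equation $F(u)=y$. $\alpha\sim\delta$ means that $\alpha=\alpha(\delta)$ is of the same order as $\delta$ (the ratio is bounded above and below by positive constants). Standing assumptions. (A1) $U$ and $H$ carry topologies $\tau_U$ and $\tau_H$, respectively, weaker than the norm topologies. (A2) The topological duals of $U$, $H$ are denoted $U^*$, $H^*$. (A3) The norm of $H$ is sequentially lower semicontinuous with respect to $\tau_H$. (A4) $\mathscr{D}(F)$ has non-empty interior in the norm topology and is $\tau_U$-closed; $\mathscr{D}(F)\cap\operatorname{dom}h\ne\emptyset$. (A5) $F:\mathscr{D}(F)\subseteq U\to H$ is continuous from $(U,\tau_U)$ to $(H,\tau_H)$. (A6) $h:U\to[0,+\infty]$ is proper, convex, bounded from below and $\tau_U$-lower semicontinuous; $\operatorname{dom}h=\{u: h(u)<\infty\}$. (A7) For all $M>0$, $\alpha>0$ the set $\{u : J_\alpha^\delta(u)\le M\}$ is $\tau_U$-compact in the sense that every sequence in it has a $\tau_U$-convergent subsequence. Here $J_\alpha^\delta$ is considered on $\mathscr{D}(F)$. $h$-minimizing solution: $\bar u\in\operatorname{dom}h\cap\mathscr{D}(F)$ with $F(\bar u)=y$ that minimizes $h$ among all $u$ with $F(u)=y$. Bregman distance: for $u,v\in\operatorname{dom}h$ and $\xi\in\partial h(u)\subseteq U^*$ (subdifferential), $D_h^\xi(v,u)=h(v)-h(u)-\langle\xi,v-u\rangle$.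 Assumption (N): an $h$-minimizing solution $\bar u$ of $F(u)=y$ exists, $F$ is Gâteaux differentiable, and there are $\rho>0$, $c>0$ and $\xi\in\partial h(\bar u)$ such that for every $u\in\mathscr{D}(F)\cap B_\rho(\bar u)$ ($B_\rho(\bar u)$ the ball of radius $\rho$ around $\bar u$) $$\|F(u)-F(\bar u)-F'(\bar u)(u-\bar u)\|\le c\,D_h^\xi(u,\bar u).$$ $F'(\bar u):U\to H$ is the (linear) derivative and $F'(\bar u)^*:H^*\to U^*$ its adjoint.
   Formalization: The minimizer u_α^δ is additionally assumed to lie in the open ball B_ρ(ū) on which (N) holds (for all small δ in the O(δ) part); without this the Bregman estimate and its O(δ) rate can fail. *)

theory Defs
  imports "HOL-Analysis.Analysis" "HOL-Library.Landau_Symbols"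
begin

text \<open>
  Topologies are explicit values of type \<^typ>\<open>'a topology\<close> next to the norm topology of the type
  class. The dual of a Banach space \<open>'u\<close> is \<open>'u \<Rightarrow>\<^sub>L real\<close>, with the operator norm.
  A map \<open>F\<close> defined on \<open>D\<close> is a total function, of which only the values on \<open>D\<close> matter.
  A function into \<open>[0, \<infinity>]\<close> is an \<^typ>\<open>ereal\<close>-valued function with nonnegative values.
\<close>

definition weaker_than_norm_topology :: "'a::real_normed_vector topology \<Rightarrow> bool" where
  "weaker_than_norm_topology \<tau> \<longleftrightarrow> topspace \<tau> = UNIV \<and> (\<forall>S. openin \<tau> S \<longrightarrow> open S)"

definition norm_seq_lsc :: "'a::real_normed_vector topology \<Rightarrow> bool" where
  "norm_seq_lsc \<tau> \<longleftrightarrow> (\<forall>(x::nat \<Rightarrow> 'a) l. limitin \<tau> x l sequentially \<longrightarrow>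
     ereal (norm l) \<le> liminf (\<lambda>n. ereal (norm (x n))))"

definition lsc_on_topology :: "'a topology \<Rightarrow> ('a \<Rightarrow> ereal) \<Rightarrow> bool" where
  "lsc_on_topology \<tau> h \<longleftrightarrow> (\<forall>r. openin \<tau> {u \<in> topspace \<tau>. r < h u})"

definition effective_dom :: "('a \<Rightarrow> ereal) \<Rightarrow> 'a set" where
  "effective_dom h = {u. h u < \<infinity>}"

definition ereal_proper :: "('a \<Rightarrow> ereal) \<Rightarrow> bool" where
  "ereal_proper h \<longleftrightarrow> effective_dom h \<noteq> {} \<and> (\<forall>u. h u \<noteq> -\<infinity>)"

definition ereal_convex :: "('a::real_vector \<Rightarrow> ereal) \<Rightarrow> bool" where
  "ereal_convex h \<longleftrightarrow> (\<forall>u v. \<forall>t::real. 0 < t \<and> t < 1 \<longrightarrow>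
     h ((1 - t) *\<^sub>R u + t *\<^sub>R v) \<le> ereal (1 - t) * h u + ereal t * h v)"

text \<open>The limit of the subsequence is not required to lie in \<open>S\<close>.\<close>

definition has_convergent_subsequences :: "'a topology \<Rightarrow> 'a set \<Rightarrow> bool" where
  "has_convergent_subsequences \<tau> S \<longleftrightarrow> (\<forall>x::nat \<Rightarrow> 'a. (\<forall>n. x n \<in> S) \<longrightarrow>
     (\<exists>l r. strict_mono r \<and> limitin \<tau> (x \<circ> r) l sequentially))"

definition tikhonov :: "('u \<Rightarrow> 'h::real_normed_vector) \<Rightarrow> ('u \<Rightarrow> ereal) \<Rightarrow> real \<Rightarrow> 'h \<Rightarrow> 'u \<Rightarrow> ereal" where
  "tikhonov F h \<alpha> z u = ereal (1/2 * (norm (F u - z))\<^sup>2) + ereal \<alpha> * h u"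

definition minimizing_solution ::
  "('u \<Rightarrow> 'h) \<Rightarrow> 'u set \<Rightarrow> ('u \<Rightarrow> ereal) \<Rightarrow> 'h \<Rightarrow> 'u \<Rightarrow> bool" where
  "minimizing_solution F D h y u \<longleftrightarrow>
     u \<in> effective_dom h \<and> is_arg_min h (\<lambda>v. v \<in> D \<and> F v = y) u"

text \<open>
  The step \<open>t\<close> is restricted to those keeping \<open>u + t *\<^sub>R v\<close> in \<open>D\<close>. At interior points of \<open>D\<close> this
  is the usual two-sided directional limit; at other points of \<open>D\<close> it still makes sense.
\<close>

definition has_gateaux_derivative ::
  "('u::real_normed_vector \<Rightarrow> 'h::real_normed_vector) \<Rightarrow> 'u set \<Rightarrow> 'u \<Rightarrow> ('u \<Rightarrow>\<^sub>L 'h) \<Rightarrow> bool" where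
  "has_gateaux_derivative F D u A \<longleftrightarrow> (\<forall>v.
     ((\<lambda>t::real. (F (u + t *\<^sub>R v) - F u) /\<^sub>R t) \<longlongrightarrow> blinfun_apply A v)
       (at 0 within {t. u + t *\<^sub>R v \<in> D}))"

definition subdifferential ::
  "('u::real_normed_vector \<Rightarrow> ereal) \<Rightarrow> 'u \<Rightarrow> ('u \<Rightarrow>\<^sub>L real) set" where
  "subdifferential h u = {\<xi>. u \<in> effective_dom h \<and>
     (\<forall>v. h u + ereal (blinfun_apply \<xi> (v - u)) \<le> h v)}"

text \<open>
  For \<open>u\<close> in the effective domain of \<open>h\<close>, this is the usual real number if \<open>v\<close> is also in the
  effective domain, and \<open>\<infinity>\<close> otherwise.
\<close>

definition bregman ::
  "('u::real_normed_vector \<Rightarrow> ereal) \<Rightarrow> ('u \<Rightarrow>\<^sub>L real) \<Rightarrow> 'u \<Rightarrow> 'u \<Rightarrow> ereal" where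
  "bregman h \<xi> v u = h v - h u - ereal (blinfun_apply \<xi> (v - u))"

definition dual_adjoint ::
  "('u::real_normed_vector \<Rightarrow>\<^sub>L 'h::real_normed_vector) \<Rightarrow> ('h \<Rightarrow>\<^sub>L real) \<Rightarrow> ('u \<Rightarrow>\<^sub>L real)" where
  "dual_adjoint A \<omega> = \<omega> o\<^sub>L A"

end

theory Submission
  imports Defs
begin

text \<open>
  Compare the Tikhonov functional at the minimizer \<open>u\<close> and at \<open>ubar\<close>. By the source condition,
  \<open>h u - h ubar\<close> is the Bregman distance \<open>d\<close> plus \<open>\<langle>\<omega>, F'(ubar)(u - ubar)\<rangle>\<close>, and the nonlinearity
  condition bounds the latter from below by \<open>- norm \<omega> * (s + c * d)\<close> with \<open>s = norm (F u - F ubar)\<close>.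
  Hence \<open>1/2 * (norm (F u - y\<delta>))\<^sup>2 + \<alpha> * (1 - c * norm \<omega>) * d \<le> \<delta>\<^sup>2 / 2 + \<alpha> * norm \<omega> * s\<close>. As
  \<open>s\<^sup>2 \<le> 2 * (norm (F u - y\<delta>))\<^sup>2 + 2 * \<delta>\<^sup>2\<close>, this is a quadratic inequality for \<open>s\<close>, and its solution
  then bounds \<open>d\<close>.
\<close>

text \<open>Completing the square: the hypothesis reads
  \<open>(s - 2 * p)\<^sup>2 \<le> 4 * (p\<^sup>2 + q\<^sup>2)\<close>. It is applied with
  \<open>p = \<alpha> * norm \<omega>\<close> and \<open>q = \<delta>\<close>.\<close>

lemma le_of_square_le_linear:
  fixes s p q :: real
  assumes "s\<^sup>2 \<le> 4 * p * s + 4 * q\<^sup>2"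
  shows "s \<le> 2 * p + 2 * sqrt (p\<^sup>2 + q\<^sup>2)"
proof -
  have "((s - 2 * p) / 2)\<^sup>2 \<le> p\<^sup>2 + q\<^sup>2"
    using assms by (simp add: power2_eq_square field_simps)
  then have "(s - 2 * p) / 2 \<le> sqrt (p\<^sup>2 + q\<^sup>2)"
    by (rule real_le_rsqrt)
  then show ?thesis
    by simp
qed

text \<open>The subgradient inequality rearranged. Subtracting \<open>h u\<close> is safe in
  \<open>ereal\<close> because \<open>h u\<close> is finite; outside the effective domain of
  \<open>h\<close> the distance is infinite.\<close>

lemma bregman_nonneg:
  assumes "\<xi> \<in> subdifferential h u" and "0 \<le> h u"
  shows "0 \<le> bregman h \<xi> v u"
proof -
  obtain b where b: "h u = ereal b"
    using assms by (cases "h u") (auto simp: subdifferential_def effective_dom_def)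
  have "h u + ereal (blinfun_apply \<xi> (v - u)) \<le> h v"
    using assms by (simp add: subdifferential_def)
  then show ?thesis
    using b by (cases "h v") (auto simp: bregman_def)
qed

lemma tikhonov_bregman_inequality:
  fixes F :: "'u::real_normed_vector \<Rightarrow> 'h::real_normed_vector" and A :: "'u \<Rightarrow>\<^sub>L 'h"
  assumes h_nonneg: "\<And>v. 0 \<le> h v"
    and ubar: "ubar \<in> D" "h ubar < \<infinity>"
    and data: "norm (F ubar - z) \<le> \<delta>"
    and \<alpha>: "\<alpha> > 0"
    and min: "is_arg_min (tikhonov F h \<alpha> z) (\<lambda>v. v \<in> D) u"
    and nonlin: "ereal (norm (F u - F ubar - blinfun_apply A (u - ubar)))
                   \<le> ereal c * bregman h (dual_adjoint A \<omega>) u ubar"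
  obtains d where "bregman h (dual_adjoint A \<omega>) u ubar = ereal d"
    and "1/2 * (norm (F u - z))\<^sup>2 + \<alpha> * ((1 - c * norm \<omega>) * d)
           \<le> \<delta>\<^sup>2 / 2 + \<alpha> * norm \<omega> * norm (F u - F ubar)"
proof -
  obtain b where b: "h ubar = ereal b"
    using h_nonneg[of ubar] ubar(2) by (cases "h ubar") auto
  have le: "tikhonov F h \<alpha> z u \<le> tikhonov F h \<alpha> z ubar"
    using min ubar(1) by (auto simp: is_arg_min_linorder)
  \<comment> \<open>An infinite \<open>h u\<close> would make the functional infinite at
    \<open>u\<close>, as \<alpha> > 0, but its value at \<open>ubar\<close> is finite. From here on
    the argument is real arithmetic.\<close>
  obtain a where a: "h u = ereal a"
    using le b \<alpha> h_nonneg[of u] by (cases "h u") (auto simp: tikhonov_def)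
  have min_real: "1/2 * (norm (F u - z))\<^sup>2 + \<alpha> * a \<le> 1/2 * (norm (F ubar - z))\<^sup>2 + \<alpha> * b"
    using le by (simp add: tikhonov_def a b)
  define l where "l = blinfun_apply A (u - ubar)"
  \<comment> \<open>By the source condition the subgradient acts on \<open>u - ubar\<close> as
    \<omega> acts on \<open>l\<close>, so this is the Bregman distance as a real number.\<close>
  define d where "d = a - b - blinfun_apply \<omega> l"
  define s where "s = norm (F u - F ubar)"
  have d: "bregman h (dual_adjoint A \<omega>) u ubar = ereal d"
    by (simp add: bregman_def dual_adjoint_def a b d_def l_def)
  have "norm (F u - F ubar - l) \<le> c * d"
    using nonlin by (simp add: d l_def)
  moreover have "norm l \<le> norm (F u - F ubar) + norm (F u - F ubar - l)"
    using norm_triangle_ineq4[of "F u - F ubar" "F u - F ubar - l"] by simp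
  ultimately have l: "norm l \<le> s + c * d"
    by (simp add: s_def)
  have "- blinfun_apply \<omega> l \<le> norm \<omega> * norm l"
    using norm_blinfun[of \<omega> l] by simp
  also have "\<dots> \<le> norm \<omega> * (s + c * d)"
    using l by (rule mult_left_mono) simp
  \<comment> \<open>Here \<open>a - b\<close> equals \<open>d\<close> plus \<omega> applied to
    \<open>l\<close>. The term \<open>c * d\<close> is what reduces the coefficient of
    \<open>d\<close> to \<open>1 - c * norm \<omega>\<close>.\<close>
  finally have "d - norm \<omega> * (s + c * d) \<le> a - b"
    by (simp add: d_def)
  then have "\<alpha> * (d - norm \<omega> * (s + c * d)) \<le> \<alpha> * (a - b)"
    using \<alpha> by simp
  moreover have "(norm (F ubar - z))\<^sup>2 \<le> \<delta>\<^sup>2"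
    using data by (intro power_mono) auto
  ultimately have "1/2 * (norm (F u - z))\<^sup>2 + \<alpha> * ((1 - c * norm \<omega>) * d)
      \<le> \<delta>\<^sup>2 / 2 + \<alpha> * norm \<omega> * s"
    using min_real by (simp add: algebra_simps)
  then show ?thesis
    using that d by (simp add: s_def)
qed

text \<open>The nonlinearity estimate is asked at the minimizer alone, so that an estimate valid
  only near \<open>ubar\<close> suffices for each minimizer close to it.\<close>

lemma tikhonov_error_bounds:
  fixes F :: "'u::real_normed_vector \<Rightarrow> 'h::real_normed_vector" and A :: "'u \<Rightarrow>\<^sub>L 'h"
  assumes h_nonneg: "\<And>v. 0 \<le> h v"
    and ubar: "ubar \<in> D" "h ubar < \<infinity>"
    and subgrad: "dual_adjoint A \<omega> \<in> subdifferential h ubar"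
    and small: "c * norm \<omega> < 1"
    and data: "norm (F ubar - z) \<le> \<delta>"
    and \<alpha>: "\<alpha> > 0"
    and min: "is_arg_min (tikhonov F h \<alpha> z) (\<lambda>v. v \<in> D) u"
    and nonlin: "ereal (norm (F u - F ubar - blinfun_apply A (u - ubar)))
                   \<le> ereal c * bregman h (dual_adjoint A \<omega>) u ubar"
  shows "norm (F u - F ubar) \<le> 2 * \<alpha> * norm \<omega> + 2 * sqrt (\<alpha>\<^sup>2 * (norm \<omega>)\<^sup>2 + \<delta>\<^sup>2)" (is ?residual)
    and "bregman h (dual_adjoint A \<omega>) u ubar
           \<le> ereal (2 / (1 - c * norm \<omega>) *
               (\<delta>\<^sup>2 / (2 * \<alpha>) + \<alpha> * (norm \<omega>)\<^sup>2 + norm \<omega> * sqrt (\<alpha>\<^sup>2 * (norm \<omega>)\<^sup>2 + \<delta>\<^sup>2)))"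
      (is ?bregman)
proof -
  define s where "s = norm (F u - F ubar)"
  define r where "r = norm (F u - z)"
  define w where "w = norm \<omega>"
  define q where "q = sqrt (\<alpha>\<^sup>2 * w\<^sup>2 + \<delta>\<^sup>2)"
  obtain d where d: "bregman h (dual_adjoint A \<omega>) u ubar = ereal d"
    and est: "1/2 * r\<^sup>2 + \<alpha> * ((1 - c * w) * d) \<le> \<delta>\<^sup>2 / 2 + \<alpha> * w * s"
    unfolding r_def w_def s_def
    using tikhonov_bregman_inequality[OF h_nonneg ubar data \<alpha> min nonlin] by blast
  have pos: "0 < 1 - c * w"
    using small by (simp add: w_def)
  \<comment> \<open>For the residual bound the Bregman term is discarded, which its sign
    allows.\<close>
  have "0 \<le> d"
    using bregman_nonneg[OF subgrad h_nonneg, of u] d by simp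
  then have "0 \<le> \<alpha> * ((1 - c * w) * d)"
    using pos \<alpha> by simp
  then have "1/2 * r\<^sup>2 \<le> \<delta>\<^sup>2 / 2 + \<alpha> * w * s"
    using est by linarith
  moreover have "s \<le> r + \<delta>"
    using norm_triangle_ineq4[of "F u - z" "F ubar - z"] data by (simp add: s_def r_def)
  then have "s\<^sup>2 \<le> (r + \<delta>)\<^sup>2"
    by (rule power_mono) (simp add: s_def)
  moreover have "(r + \<delta>)\<^sup>2 \<le> 2 * r\<^sup>2 + 2 * \<delta>\<^sup>2"
    using zero_le_power2[of "r - \<delta>"] by (simp add: power2_eq_square algebra_simps)
  \<comment> \<open>Insert \<open>r\<^sup>2 \<le> \<delta>\<^sup>2 + 2 * \<alpha> * w * s\<close>
    into \<open>s\<^sup>2 \<le> 2 * r\<^sup>2 + 2 * \<delta>\<^sup>2\<close>.\<close>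
  ultimately have "s\<^sup>2 \<le> 4 * (\<alpha> * w) * s + 4 * \<delta>\<^sup>2"
    by linarith
  from le_of_square_le_linear[OF this] have s: "s \<le> 2 * \<alpha> * w + 2 * q"
    by (simp add: q_def power_mult_distrib)
  then show ?residual
    by (simp add: s_def w_def q_def)
  \<comment> \<open>Now the residual term is discarded instead, and the bound on \<open>s\<close>
    controls the right-hand side.\<close>
  have "0 \<le> r\<^sup>2" by simp
  then have "\<alpha> * ((1 - c * w) * d) \<le> \<delta>\<^sup>2 / 2 + \<alpha> * w * s"
    using est by linarith
  also have "\<alpha> * w * s \<le> \<alpha> * w * (2 * \<alpha> * w + 2 * q)"
    using s \<alpha> by (intro mult_left_mono) (auto simp: w_def)
  also have "\<delta>\<^sup>2 / 2 + \<alpha> * w * (2 * \<alpha> * w + 2 * q)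
      = \<alpha> * (\<delta>\<^sup>2 / (2 * \<alpha>) + 2 * (\<alpha> * w\<^sup>2 + w * q))"
    using \<alpha> by (simp add: field_simps power2_eq_square)
  finally have "(1 - c * w) * d \<le> \<delta>\<^sup>2 / (2 * \<alpha>) + 2 * (\<alpha> * w\<^sup>2 + w * q)"
    using \<alpha> by simp
  \<comment> \<open>Doubling the first summand as well is a loss, made to reach the stated form with
    the common factor 2.\<close>
  also have "\<dots> \<le> 2 * (\<delta>\<^sup>2 / (2 * \<alpha>) + \<alpha> * w\<^sup>2 + w * q)"
    using \<alpha> by (simp add: frac_le)
  finally have "d \<le> 2 / (1 - c * w) * (\<delta>\<^sup>2 / (2 * \<alpha>) + \<alpha> * w\<^sup>2 + w * q)"
    using pos by (simp add: pos_le_divide_eq mult.commute)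
  then show ?bregman
    by (simp add: d w_def q_def)
qed

text \<open>The root is at most the sum of the absolute values. This uses the upper half of \<alpha>
  ~ \<delta>.\<close>

lemma sqrt_sum_squares_bigo:
  fixes \<alpha> :: "real \<Rightarrow> real"
  assumes "\<alpha> \<in> O[at_right 0](\<lambda>\<delta>. \<delta>)"
  shows "(\<lambda>\<delta>. sqrt ((\<alpha> \<delta>)\<^sup>2 * w\<^sup>2 + \<delta>\<^sup>2)) \<in> O[at_right 0](\<lambda>\<delta>. \<delta>)"
proof (rule landau_o.big_trans)
  have "sqrt ((\<alpha> \<delta>)\<^sup>2 * w\<^sup>2 + \<delta>\<^sup>2) \<le> \<bar>\<alpha> \<delta> * w\<bar> + \<bar>\<delta>\<bar>" for \<delta>
    using sqrt_sum_squares_le_sum_abs[of "\<alpha> \<delta> * w" \<delta>] by (simp add: power_mult_distrib)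
  then show "(\<lambda>\<delta>. sqrt ((\<alpha> \<delta>)\<^sup>2 * w\<^sup>2 + \<delta>\<^sup>2)) \<in> O[at_right 0](\<lambda>\<delta>. \<bar>\<alpha> \<delta> * w\<bar> + \<bar>\<delta>\<bar>)"
    by (intro landau_o.big_mono always_eventually) simp
  have "(\<lambda>\<delta>. \<alpha> \<delta> * w) \<in> O[at_right 0](\<lambda>\<delta>. \<delta>)"
    \<comment> \<open>Cancelling a constant factor inside a Landau set requires it to be
      nonzero.\<close>
    using assms by (cases "w = 0") simp_all
  then show "(\<lambda>\<delta>. \<bar>\<alpha> \<delta> * w\<bar> + \<bar>\<delta>\<bar>) \<in> O[at_right 0](\<lambda>\<delta>. \<delta>)"
    by (intro sum_in_bigo) simp_all
qed

text \<open>The lower half of \<alpha> ~ \<delta> enters here: dividing by \<alpha> costs no more,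
  up to a constant, than dividing by \<delta>.\<close>

lemma square_over_bigtheta:
  fixes \<alpha> :: "real \<Rightarrow> real"
  assumes "\<alpha> \<in> \<Theta>[at_right 0](\<lambda>\<delta>. \<delta>)"
  shows "(\<lambda>\<delta>. \<delta>\<^sup>2 / \<alpha> \<delta>) \<in> O[at_right 0](\<lambda>\<delta>. \<delta>)"
proof -
  have nz: "\<forall>\<^sub>F \<delta> in at_right 0. \<delta> \<noteq> (0::real)"
    by (rule eventually_neq_at_within)
  then have "\<forall>\<^sub>F \<delta> in at_right 0. \<alpha> \<delta> \<noteq> 0"
    using eventually_nonzero_bigtheta[OF assms] by simp
  then have "(\<lambda>\<delta>. \<delta>\<^sup>2 / \<alpha> \<delta>) \<in> \<Theta>[at_right 0](\<lambda>\<delta>. \<delta>\<^sup>2 / \<delta>)"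
    using nz assms by (intro landau_theta.divide) (simp_all add: bigtheta_sym)
  then show ?thesis
    by (simp add: power2_eq_square bigthetaD1)
qed

text \<open>The minimizer is assumed to lie in \<open>ball ubar \<rho>\<close>, where the
  nonlinearity condition holds. Compactness (A7) involves the data, so it is stated for each noisy
  datum. Landau sets need real functions, hence \<open>real_of_ereal\<close> in the rate for the
  Bregman distance.\<close>

theorem theorem3p2:
  fixes F :: "'u::banach \<Rightarrow> 'h::banach"
    and D :: "'u set"
    and h :: "'u \<Rightarrow> ereal"
    and \<tau>U :: "'u topology"
    and \<tau>H :: "'h topology"
    and F' :: "'u \<Rightarrow> ('u \<Rightarrow>\<^sub>L 'h)"
    and y :: 'h
    and ubar :: 'u
    and \<xi> :: "'u \<Rightarrow>\<^sub>L real"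
    and \<omega> :: "'h \<Rightarrow>\<^sub>L real"
    and \<rho> c :: real
  assumes A1: "weaker_than_norm_topology \<tau>U" "weaker_than_norm_topology \<tau>H"
    and A3: "norm_seq_lsc \<tau>H"
    and A4: "interior D \<noteq> {}" "closedin \<tau>U D" "D \<inter> effective_dom h \<noteq> {}"
    and A5: "continuous_map (subtopology \<tau>U D) \<tau>H F"
    and A6: "\<forall>u. 0 \<le> h u" "ereal_proper h" "ereal_convex h"
            "\<exists>m::real. \<forall>u. ereal m \<le> h u" "lsc_on_topology \<tau>U h"
    and ubar: "minimizing_solution F D h y ubar"
    and gateaux: "\<forall>u\<in>D. has_gateaux_derivative F D u (F' u)"
    and \<rho>: "\<rho> > 0"
    and c: "c > 0"
    and \<xi>: "\<xi> \<in> subdifferential h ubar"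
    and N: "\<forall>u \<in> D \<inter> ball ubar \<rho>.
              ereal (norm (F u - F ubar - blinfun_apply (F' ubar) (u - ubar)))
                \<le> ereal c * bregman h \<xi> u ubar"
    and source: "\<xi> = dual_adjoint (F' ubar) \<omega>"
    and small: "c * norm \<omega> < 1"
  shows
    "(\<forall>(\<delta>::real) (\<alpha>::real) (y\<delta>::'h) (u::'u).
        \<delta> > 0 \<and> norm (y - y\<delta>) < \<delta> \<and> \<alpha> > 0
        \<and> (\<forall>M>0. \<forall>\<beta>>0. has_convergent_subsequences \<tau>U {v \<in> D. tikhonov F h \<beta> y\<delta> v \<le> ereal M})
        \<and> is_arg_min (tikhonov F h \<alpha> y\<delta>) (\<lambda>v. v \<in> D) u
        \<and> u \<in> ball ubar \<rho>
        \<longrightarrow>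
        norm (F u - F ubar) \<le> 2 * \<alpha> * norm \<omega> + 2 * sqrt (\<alpha>\<^sup>2 * (norm \<omega>)\<^sup>2 + \<delta>\<^sup>2)
        \<and> bregman h (dual_adjoint (F' ubar) \<omega>) u ubar
            \<le> ereal (2 / (1 - c * norm \<omega>) *
                 (\<delta>\<^sup>2 / (2 * \<alpha>) + \<alpha> * (norm \<omega>)\<^sup>2 + norm \<omega> * sqrt (\<alpha>\<^sup>2 * (norm \<omega>)\<^sup>2 + \<delta>\<^sup>2))))
     \<and>
     (\<forall>(\<alpha>::real \<Rightarrow> real) (y\<delta>::real \<Rightarrow> 'h) (u::real \<Rightarrow> 'u).
        (\<forall>\<^sub>F \<delta> in at_right 0.
            norm (y - y\<delta> \<delta>) < \<delta> \<and> \<alpha> \<delta> > 0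
            \<and> (\<forall>M>0. \<forall>\<beta>>0. has_convergent_subsequences \<tau>U {v \<in> D. tikhonov F h \<beta> (y\<delta> \<delta>) v \<le> ereal M})
            \<and> is_arg_min (tikhonov F h (\<alpha> \<delta>) (y\<delta> \<delta>)) (\<lambda>v. v \<in> D) (u \<delta>)
            \<and> u \<delta> \<in> ball ubar \<rho>)
        \<and> \<alpha> \<in> \<Theta>[at_right 0](\<lambda>\<delta>. \<delta>)
        \<longrightarrow>
        (\<lambda>\<delta>. norm (F (u \<delta>) - F ubar)) \<in> O[at_right 0](\<lambda>\<delta>. \<delta>)
        \<and> (\<lambda>\<delta>. real_of_ereal (bregman h (dual_adjoint (F' ubar) \<omega>) (u \<delta>) ubar)) \<in> O[at_right 0](\<lambda>\<delta>. \<delta>))"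
proof -
  let ?b = "\<lambda>u. bregman h (dual_adjoint (F' ubar) \<omega>) u ubar"
  let ?w = "norm \<omega>"
  let ?q = "\<lambda>\<delta> \<alpha>. sqrt (\<alpha>\<^sup>2 * ?w\<^sup>2 + \<delta>\<^sup>2)"
  let ?B = "\<lambda>\<delta> \<alpha>. 2 / (1 - c * ?w) * (\<delta>\<^sup>2 / (2 * \<alpha>) + \<alpha> * ?w\<^sup>2 + ?w * ?q \<delta> \<alpha>)"
  have ubar': "ubar \<in> D" "h ubar < \<infinity>" "F ubar = y"
    using ubar by (auto simp: minimizing_solution_def is_arg_min_linorder effective_dom_def)
  have subgrad: "dual_adjoint (F' ubar) \<omega> \<in> subdifferential h ubar"
    using \<xi> source by simp
  have bounds: "norm (F u - F ubar) \<le> 2 * \<alpha> * ?w + 2 * ?q \<delta> \<alpha>" "?b u \<le> ereal (?B \<delta> \<alpha>)"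
    if "norm (y - z) < \<delta>" "\<alpha> > 0" "is_arg_min (tikhonov F h \<alpha> z) (\<lambda>v. v \<in> D) u"
      "u \<in> ball ubar \<rho>" for \<delta> \<alpha> z u
  proof -
    have "u \<in> D"
      using that(3) by (simp add: is_arg_min_linorder)
    then have nonlin: "ereal (norm (F u - F ubar - blinfun_apply (F' ubar) (u - ubar))) \<le> ereal c * ?b u"
      using N that(4) source by simp
    have data: "norm (F ubar - z) \<le> \<delta>"
      using that(1) ubar'(3) by simp
    show "norm (F u - F ubar) \<le> 2 * \<alpha> * ?w + 2 * ?q \<delta> \<alpha>" "?b u \<le> ereal (?B \<delta> \<alpha>)"
      using tikhonov_error_bounds[OF _ ubar'(1,2) subgrad small data that(2,3) nonlin] A6(1) by auto
  qed
  have rates: "(\<lambda>\<delta>. norm (F (u \<delta>) - F ubar)) \<in> O[at_right 0](\<lambda>\<delta>. \<delta>)"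
      "(\<lambda>\<delta>. real_of_ereal (?b (u \<delta>))) \<in> O[at_right 0](\<lambda>\<delta>. \<delta>)"
    if ev: "\<forall>\<^sub>F \<delta> in at_right 0. norm (y - y\<delta> \<delta>) < \<delta> \<and> \<alpha> \<delta> > 0
          \<and> is_arg_min (tikhonov F h (\<alpha> \<delta>) (y\<delta> \<delta>)) (\<lambda>v. v \<in> D) (u \<delta>) \<and> u \<delta> \<in> ball ubar \<rho>"
      and \<alpha>: "\<alpha> \<in> \<Theta>[at_right 0](\<lambda>\<delta>. \<delta>)" for \<alpha> :: "real \<Rightarrow> real" and y\<delta> u
  proof -
    have \<alpha>O: "\<alpha> \<in> O[at_right 0](\<lambda>\<delta>. \<delta>)"
      using \<alpha> by (rule bigthetaD1)
    have cmult: "(\<lambda>\<delta>. k * f \<delta>) \<in> O[at_right 0](\<lambda>\<delta>. \<delta>)"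
      if "f \<in> O[at_right 0](\<lambda>\<delta>. \<delta>)" for k :: real and f :: "real \<Rightarrow> real"
      using that by (cases "k = 0") simp_all
    note q = sqrt_sum_squares_bigo[OF \<alpha>O, of ?w]
    have "(\<lambda>\<delta>. (2 * ?w) * \<alpha> \<delta> + 2 * ?q \<delta> (\<alpha> \<delta>)) \<in> O[at_right 0](\<lambda>\<delta>. \<delta>)"
      by (intro sum_in_bigo cmult \<alpha>O q)
    moreover have "(\<lambda>\<delta>. norm (F (u \<delta>) - F ubar))
        \<in> O[at_right 0](\<lambda>\<delta>. (2 * ?w) * \<alpha> \<delta> + 2 * ?q \<delta> (\<alpha> \<delta>))"
    proof (intro landau_o.big_mono eventually_mono[OF ev], elim conjE)
      fix \<delta>
      assume "norm (y - y\<delta> \<delta>) < \<delta>" "\<alpha> \<delta> > 0"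
        "is_arg_min (tikhonov F h (\<alpha> \<delta>) (y\<delta> \<delta>)) (\<lambda>v. v \<in> D) (u \<delta>)" "u \<delta> \<in> ball ubar \<rho>"
      from bounds(1)[OF this]
      show "norm (norm (F (u \<delta>) - F ubar)) \<le> norm ((2 * ?w) * \<alpha> \<delta> + 2 * ?q \<delta> (\<alpha> \<delta>))"
        by (simp add: mult_ac)
    qed
    ultimately show "(\<lambda>\<delta>. norm (F (u \<delta>) - F ubar)) \<in> O[at_right 0](\<lambda>\<delta>. \<delta>)"
      by (rule landau_o.big_trans[rotated])
    \<comment> \<open>The bound \<open>?B\<close>, rewritten so that every summand is a constant
      times a function already known to be of order \<delta>.\<close>
    have "(\<lambda>\<delta>. 2 / (1 - c * ?w) * (1/2 * (\<delta>\<^sup>2 / \<alpha> \<delta>) + ?w\<^sup>2 * \<alpha> \<delta> + ?w * ?q \<delta> (\<alpha> \<delta>)))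
        \<in> O[at_right 0](\<lambda>\<delta>. \<delta>)"
      by (intro sum_in_bigo cmult \<alpha>O q square_over_bigtheta[OF \<alpha>])
    then have "(\<lambda>\<delta>. ?B \<delta> (\<alpha> \<delta>)) \<in> O[at_right 0](\<lambda>\<delta>. \<delta>)"
      by (simp add: mult.commute)
    moreover have "(\<lambda>\<delta>. real_of_ereal (?b (u \<delta>))) \<in> O[at_right 0](\<lambda>\<delta>. ?B \<delta> (\<alpha> \<delta>))"
    proof (intro landau_o.big_mono eventually_mono[OF ev], elim conjE)
      fix \<delta>
      assume "norm (y - y\<delta> \<delta>) < \<delta>" "\<alpha> \<delta> > 0"
        "is_arg_min (tikhonov F h (\<alpha> \<delta>) (y\<delta> \<delta>)) (\<lambda>v. v \<in> D) (u \<delta>)" "u \<delta> \<in> ball ubar \<rho>"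
      from bounds(2)[OF this] have "?b (u \<delta>) \<le> ereal (?B \<delta> (\<alpha> \<delta>))" .
      \<comment> \<open>With the upper bound this makes the distance finite, so
        \<open>real_of_ereal\<close> returns its true value and not the default 0, and the absolute
        value is harmless.\<close>
      moreover have "0 \<le> ?b (u \<delta>)"
        using bregman_nonneg[OF subgrad] A6(1) by simp
      ultimately have "\<bar>real_of_ereal (?b (u \<delta>))\<bar> \<le> ?B \<delta> (\<alpha> \<delta>)"
        by (cases "?b (u \<delta>)") auto
      then show "norm (real_of_ereal (?b (u \<delta>))) \<le> norm (?B \<delta> (\<alpha> \<delta>))"
        unfolding real_norm_def by (rule order_trans[OF _ abs_ge_self])
    qed
    ultimately show "(\<lambda>\<delta>. real_of_ereal (?b (u \<delta>))) \<in> O[at_right 0](\<lambda>\<delta>. \<delta>)"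
      by (rule landau_o.big_trans[rotated])
  qed
  show ?thesis
  proof (intro conjI allI impI; elim conjE)
    fix \<alpha> :: "real \<Rightarrow> real" and y\<delta> u
    assume ev: "\<forall>\<^sub>F \<delta> in at_right 0.
            norm (y - y\<delta> \<delta>) < \<delta> \<and> \<alpha> \<delta> > 0
            \<and> (\<forall>M>0. \<forall>\<beta>>0. has_convergent_subsequences \<tau>U {v \<in> D. tikhonov F h \<beta> (y\<delta> \<delta>) v \<le> ereal M})
            \<and> is_arg_min (tikhonov F h (\<alpha> \<delta>) (y\<delta> \<delta>)) (\<lambda>v. v \<in> D) (u \<delta>)
            \<and> u \<delta> \<in> ball ubar \<rho>"
      and \<alpha>: "\<alpha> \<in> \<Theta>[at_right 0](\<lambda>\<delta>. \<delta>)"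
    have ev': "\<forall>\<^sub>F \<delta> in at_right 0. norm (y - y\<delta> \<delta>) < \<delta> \<and> \<alpha> \<delta> > 0
          \<and> is_arg_min (tikhonov F h (\<alpha> \<delta>) (y\<delta> \<delta>)) (\<lambda>v. v \<in> D) (u \<delta>) \<and> u \<delta> \<in> ball ubar \<rho>"
      using ev by (rule eventually_mono) blast
    show "(\<lambda>\<delta>. norm (F (u \<delta>) - F ubar)) \<in> O[at_right 0](\<lambda>\<delta>. \<delta>)"
      "(\<lambda>\<delta>. real_of_ereal (?b (u \<delta>))) \<in> O[at_right 0](\<lambda>\<delta>. \<delta>)"
      using rates[OF ev' \<alpha>] by blast+
  qed (use bounds in blast)+
qed

end
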